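(* For every $n\in\mathbb{N}$ the following relations hold in $U$: $$[y,(xxyy)^nxxy]_q=(q-q^{-3})\left(yxx(yyxx)^ny-(xxyy)^{n+1}\right),$$ $$[(yyxx)^nyyx,y]_q=0,$$ $$[y,(xxyy)^nx]_q=(q-q^{-3})y(xxyy)^nx,$$ $$[(yyxx)^ny,y]_q=(q^3-q^{-1})(yyxx)^nyy.$$
   Context: Let $\mathbb{F}$ be a field of characteristic zero and let $q\in\mathbb{F}$ be nonzero and not a root of unity; $\mathbb{N}=\{0,1,2,\ldots\}$. Let $\mathbb{V}$ be the free associative unital $\mathbb{F}$-algebra on two noncommuting generators (letters) $x,y$; the words in $x,y$ (including the trivial word $\mathbf{1}$) form a basis of $\mathbb{V}$. Words such as $(xxyy)^nx$ are written with respect to the free (concatenation) product. The $q$-shuffle product $\star$ on the vector space $\mathbb{V}$ is the bilinear associative product with unit $\mathbf{1}$ determined as follows. Put $\langle x,x\rangle=\langle y,y\rangle=2$ and $\langle x,y\rangle=\langle y,x\rangle=-2$. For nontrivial words $u=u_1\cdots u_r$ and $v=v_1\cdots v_s$, $$u\star v=u_1\big((u_2\cdots u_r)\star v\big)+v_1\big(u\star(v_2\cdots v_s)\big)q^{\langle v_1,u_1\rangle+\cdots+\langle v_1,u_r\rangle}.$$ $U$ denotes the subalgebra of $(\mathbb{V},\star)$ generated by $x,y$; all the words in the statement lie in $U$. The $q$-commutator is taken with respect to $\star$: $[X,Y]_q=qX\star Y-q^{-1}Y\star X$. *)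

theory Defs
  imports "HOL-Library.Poly_Mapping"
begin

datatype letter = X | Y

text \<open>
  Words form a monoid under concatenation, written additively because this is the form in which
  \<^theory>\<open>HOL-Library.Poly_Mapping\<close> provides monoid algebras. With this instance, \<open>*\<close>, \<open>^\<close> and \<open>1\<close>
  on finitely supported functions from words to a field are the multiplication, powers and unit
  of the free associative algebra on \<open>x\<close>, \<open>y\<close>, and \<open>single w 1\<close> is the basis element \<open>w\<close>.
\<close>

instantiation list :: (type) monoid_add
begin

definition zero_list :: "'a list" where "0 = []"

definition plus_list :: "'a list \<Rightarrow> 'a list \<Rightarrow> 'a list" where "u + v = u @ v"

instance by standard (simp_all add: zero_list_def plus_list_def)

end

type_synonym 'f free_alg = "letter list \<Rightarrow>\<^sub>0 'f"

definition gen :: "letter \<Rightarrow> 'f::field free_alg" where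
  "gen a = Poly_Mapping.single [a] 1"

abbreviation gen_x :: "'f::field free_alg" ("\<xx>") where "\<xx> \<equiv> gen X"
abbreviation gen_y :: "'f::field free_alg" ("\<yy>") where "\<yy> \<equiv> gen Y"

definition scal :: "'f::field \<Rightarrow> 'f free_alg \<Rightarrow> 'f free_alg" (infixr "\<odot>" 75) where
  "c \<odot> p = Poly_Mapping.single 0 c * p"

definition pairing :: "letter \<Rightarrow> letter \<Rightarrow> int" where
  "pairing a b = (if a = b then 2 else -2)"

fun word_qshuffle :: "'f::field \<Rightarrow> letter list \<Rightarrow> letter list \<Rightarrow> 'f free_alg" where
  "word_qshuffle q [] v = Poly_Mapping.single v 1"
| "word_qshuffle q (a # u) [] = Poly_Mapping.single (a # u) 1"
| "word_qshuffle q (a # u) (b # v) =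
     gen a * word_qshuffle q u (b # v)
     + (q powi (\<Sum>c\<leftarrow>a # u. pairing b c)) \<odot> (gen b * word_qshuffle q (a # u) v)"

text \<open>Bilinear extension of the \<open>q\<close>-shuffle product from words to the whole space.
  The algebra \<open>U\<close> generated by \<open>x\<close>, \<open>y\<close> under this product is a subalgebra, so a relation between
  elements of \<open>U\<close> is the same equation read in the whole space.\<close>

definition qshuffle :: "'f::field \<Rightarrow> 'f free_alg \<Rightarrow> 'f free_alg \<Rightarrow> 'f free_alg" where
  "qshuffle q p r =
     (\<Sum>u\<in>Poly_Mapping.keys p. \<Sum>v\<in>Poly_Mapping.keys r.
        (Poly_Mapping.lookup p u * Poly_Mapping.lookup r v) \<odot> word_qshuffle q u v)"

definition qcommutator :: "'f::field \<Rightarrow> 'f free_alg \<Rightarrow> 'f free_alg \<Rightarrow> 'f free_alg" where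
  "qcommutator q p r = q \<odot> qshuffle q p r - inverse q \<odot> qshuffle q r p"

lemma single_word_mult:
  "Poly_Mapping.single u (1::'f::field) * Poly_Mapping.single v 1 = Poly_Mapping.single (u @ v) 1"
  by (simp add: mult_single plus_list_def)

lemma lookup_scal: "Poly_Mapping.lookup (c \<odot> p) w = c * Poly_Mapping.lookup p w"
  by (simp add: scal_def Poly_Mapping.map.rep_eq when_def flip: mult_map_scale_conv_mult)

lemma qshuffle_words:
  "qshuffle q (Poly_Mapping.single u 1) (Poly_Mapping.single v 1) = word_qshuffle q u v"
  by (rule poly_mapping_eqI) (simp add: qshuffle_def lookup_scal)

lemma qshuffle_word_Cons:
  "qshuffle q (Poly_Mapping.single (a # u) 1) (Poly_Mapping.single (b # v) 1) =
     gen a * qshuffle q (Poly_Mapping.single u 1) (Poly_Mapping.single (b # v) 1)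
     + (q powi (\<Sum>c\<leftarrow>a # u. pairing b c)) \<odot>
       (gen b * qshuffle q (Poly_Mapping.single (a # u) 1) (Poly_Mapping.single v 1))"
  by (simp only: qshuffle_words word_qshuffle.simps)

end

theory Submission
  imports Defs
begin

text \<open>
  In \<open>y \<star> v\<close> and \<open>v \<star> y\<close> the letter \<open>y\<close> is inserted into \<open>v\<close> at every position. If \<open>v\<close> has total
  pairing \<open>-2\<close> with \<open>y\<close>, the insertion after a prefix of pairing \<open>p\<close> occurs in \<open>[y, v]\<^sub>q\<close> with
  coefficient \<open>q\<^bsup>p+1\<^esup> - q\<^bsup>-p-3\<^esup>\<close>, which vanishes for \<open>p = -2\<close> and is opposite for \<open>p = 0\<close> and
  \<open>p = -4\<close>. Inside a block \<open>xxyy\<close> the insertion after \<open>xx\<close> is therefore cancelled by the one after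
  \<open>xxyy\<close>, so that \<open>v \<mapsto> [y, v]\<^sub>q - (q - q\<^bsup>-3\<^esup>) y v\<close> commutes with prepending \<open>xxyy\<close>. In the same way
  \<open>v \<mapsto> [v, y]\<^sub>q\<close> commutes with prepending \<open>yyxx\<close> when \<open>v\<close> has total pairing \<open>2\<close> with \<open>y\<close>, and all
  four relations reduce to \<open>n = 0\<close>.
\<close>

text \<open>Applied with \<open>p = xx\<close>, it slides \<open>xx\<close> through
  \<open>(yyxx)^n\<close>, turning it into \<open>(xxyy)^n\<close>.\<close>

lemma mult_power_intertwine:
  fixes p a b :: "'a::monoid_mult"
  assumes "p * b = a * p"
  shows "p * b^n = a^n * p"
proof (induction n)
  case (Suc n)
  have "p * b^Suc n = (p * b) * b^n"
    by (simp add: mult.assoc)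
  also have "\<dots> = a * (p * b^n)"
    by (simp only: assms mult.assoc)
  also have "\<dots> = a^Suc n * p"
    by (simp only: Suc power_Suc mult.assoc)
  finally show ?case .
qed simp

lemma scal_mult_left: "(c \<odot> p) * r = c \<odot> (p * r)"
  by (simp add: scal_def mult.assoc)

lemma scal_scal: "c \<odot> (d \<odot> p) = (c * d) \<odot> p"
  by (simp add: scal_def mult_single flip: mult.assoc)

lemma scal_add_right: "c \<odot> (p + r) = c \<odot> p + c \<odot> r"
  by (simp add: scal_def distrib_left)

lemma scal_diff_left: "(c - d) \<odot> p = c \<odot> p - d \<odot> p"
  by (simp add: scal_def single_diff left_diff_distrib)

lemma gen_mult_single: "gen a * Poly_Mapping.single v 1 = Poly_Mapping.single (a # v) 1"
  by (simp add: gen_def single_word_mult)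

text \<open>Scaling is left multiplication by a multiple of the unit, so the claim is that such
  multiples are central; this is checked one word of \<open>p\<close> at a time.\<close>

lemma mult_scal_right:
  fixes p r :: "'f::field free_alg"
  shows "p * (c \<odot> r) = c \<odot> (p * r)"
proof -
  have "p * Poly_Mapping.single 0 c = Poly_Mapping.single 0 c * p"
  proof (induction p rule: update_induct)
    case const
    show ?case by simp
  next
    case (update p v d)
    have "Poly_Mapping.update v d p = Poly_Mapping.single v d + p"
      using update by (intro poly_mapping_eqI)
        (auto simp: lookup_update lookup_add lookup_single in_keys_iff when_def)
    with update show ?case
      by (simp add: distrib_left distrib_right mult_single mult.commute)
  qed
  then show ?thesis
    unfolding scal_def by (metis mult.assoc)
qed

definition y_weight :: "letter list \<Rightarrow> int" where
  "y_weight v = (\<Sum>c\<leftarrow>v. pairing Y c)"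

lemma y_weight_simps:
  "y_weight [] = 0"
  "y_weight (X # v) = y_weight v - 2"
  "y_weight (Y # v) = y_weight v + 2"
  by (simp_all add: y_weight_def pairing_def)

lemma word_qshuffle_y_left:
  "word_qshuffle q [Y] [] = Poly_Mapping.single [Y] 1"
  "word_qshuffle q [Y] (X # v) =
     Poly_Mapping.single (Y # X # v) 1 + (q powi - 2) \<odot> (\<xx> * word_qshuffle q [Y] v)"
  "word_qshuffle q [Y] (Y # v) =
     Poly_Mapping.single (Y # Y # v) 1 + (q powi 2) \<odot> (\<yy> * word_qshuffle q [Y] v)"
  by (simp_all add: pairing_def gen_mult_single)

text \<open>An inserted \<open>Y\<close> carries \<open>q\<close> to the weight of the suffix behind
  it, whereas in \<open>word_qshuffle_y_left\<close> the exponent is the weight of the prefix before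
  it.\<close>

lemma word_qshuffle_y_right:
  "word_qshuffle q [] [Y] = Poly_Mapping.single [Y] 1"
  "word_qshuffle q (a # v) [Y] =
     gen a * word_qshuffle q v [Y]
     + (q powi y_weight (a # v)) \<odot> Poly_Mapping.single (Y # a # v) 1"
  by (simp_all add: y_weight_def gen_mult_single)

lemma qcommutator_y_word:
  "qcommutator q \<yy> (Poly_Mapping.single v 1) =
     q \<odot> word_qshuffle q [Y] v - inverse q \<odot> word_qshuffle q v [Y]"
  by (simp add: qcommutator_def gen_def qshuffle_words)

lemma qcommutator_word_y:
  "qcommutator q (Poly_Mapping.single v 1) \<yy> =
     q \<odot> word_qshuffle q v [Y] - inverse q \<odot> word_qshuffle q [Y] v"
  by (simp add: qcommutator_def gen_def qshuffle_words)

lemma block_words: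
  "\<xx>*\<xx>*\<yy>*\<yy> = Poly_Mapping.single [X, X, Y, Y] (1::'f::field)"
  "\<yy>*\<yy>*\<xx>*\<xx> = Poly_Mapping.single [Y, Y, X, X] (1::'f::field)"
  by (simp_all add: gen_def single_word_mult)

text \<open>Reduces each coefficient to a single integer power of \<open>q\<close>, so that opposite
  terms cancel.\<close>

lemma power_int_collect:
  fixes q :: "'f::field"
  assumes "q \<noteq> 0"
  shows "q powi m * q powi k = q powi (m + k)"
    and "q * q powi m = q powi (m + 1)"
    and "inverse q * q powi m = q powi (m - 1)"
  using assms by (simp_all add: power_int_add power_int_diff divide_inverse mult.commute)

lemmas insertion_simps =
  word_qshuffle_y_left word_qshuffle_y_right y_weight_simps
  scal_mult_left scal_scal scal_add_right scal_diff_left mult_scal_right gen_mult_single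
  distrib_left right_diff_distrib mult.assoc

text \<open>Insertions after \<open>xx\<close>, \<open>xxy\<close> and \<open>xxyy\<close> all give
  the word \<open>xxyyyv\<close>, so their coefficients \<open>q^(-3) - q\<close>, \<open>0\<close>
  and \<open>q - q^(-3)\<close> add up to zero. The subtracted terms are the insertions at the very
  front.\<close>

lemma qcommutator_y_xxyy:
  fixes q :: "'f::field"
  assumes "q \<noteq> 0" and "y_weight v = - 2"
  shows "qcommutator q \<yy> (Poly_Mapping.single (X # X # Y # Y # v) 1)
       - (q - q powi (-3)) \<odot> (\<yy> * Poly_Mapping.single (X # X # Y # Y # v) 1)
     = \<xx>*\<xx>*\<yy>*\<yy> * (qcommutator q \<yy> (Poly_Mapping.single v 1)
       - (q - q powi (-3)) \<odot> (\<yy> * Poly_Mapping.single v 1))"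
  unfolding qcommutator_y_word
  by (simp add: insertion_simps power_int_collect[OF assms(1)] assms(2)
      del: word_qshuffle.simps power_int_numeral)

text \<open>Here a prefix of weight \<open>p\<close> gives the coefficient
  \<open>q^(3-p) - q^(p-1)\<close>, zero at \<open>p = 2\<close> and opposite at \<open>0\<close>
  and \<open>4\<close>. The insertions before \<open>yyxx\<close>, after \<open>y\<close> and after
  \<open>yy\<close> give the same word and cancel, so no front term has to be subtracted.\<close>

lemma qcommutator_yyxx_y:
  fixes q :: "'f::field"
  assumes "q \<noteq> 0" and "y_weight v = 2"
  shows "qcommutator q (Poly_Mapping.single (Y # Y # X # X # v) 1) \<yy>
     = \<yy>*\<yy>*\<xx>*\<xx> * qcommutator q (Poly_Mapping.single v 1) \<yy>"
  unfolding qcommutator_word_y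
  by (simp add: insertion_simps power_int_collect[OF assms(1)] assms(2)
      del: word_qshuffle.simps power_int_numeral)

text \<open>Keeps the inductions on \<open>n\<close> among basis words of fixed weight, where the
  one-block lemmas apply.\<close>

lemma ex_word_power_mult:
  assumes "y_weight u = 0"
  shows "\<exists>w. Poly_Mapping.single u 1 ^ n * Poly_Mapping.single v 1 = Poly_Mapping.single w (1::'f::field)
     \<and> y_weight w = y_weight v"
proof (induction n)
  case 0
  then show ?case by auto
next
  case (Suc n)
  then obtain w where
    "Poly_Mapping.single u 1 ^ n * Poly_Mapping.single v 1 = Poly_Mapping.single w (1::'f)"
    and "y_weight w = y_weight v" by blast
  with assms show ?case
    by (intro exI[of _ "u @ w"]) (simp add: mult.assoc single_word_mult y_weight_def)
qed

lemma qcommutator_y_power_xxyy: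
  fixes q :: "'f::field"
  assumes "q \<noteq> 0" and "y_weight v = - 2"
  defines "b \<equiv> \<xx>*\<xx>*\<yy>*\<yy>" and "e \<equiv> Poly_Mapping.single v 1"
  shows "qcommutator q \<yy> (b^n * e) - (q - q powi (-3)) \<odot> (\<yy> * (b^n * e))
     = b^n * (qcommutator q \<yy> e - (q - q powi (-3)) \<odot> (\<yy> * e))"
proof (induction n)
  case (Suc n)
  obtain w where w: "b^n * e = Poly_Mapping.single w 1" and "y_weight w = - 2"
    using ex_word_power_mult[where 'f = 'f, of "[X, X, Y, Y]" n v] assms(2)
    unfolding b_def e_def block_words by (auto simp: y_weight_simps)
  have "b^Suc n * e = Poly_Mapping.single (X # X # Y # Y # w) 1"
    by (simp add: mult.assoc w) (simp add: b_def block_words single_word_mult)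
  then have "qcommutator q \<yy> (b^Suc n * e) - (q - q powi (-3)) \<odot> (\<yy> * (b^Suc n * e))
    = b * (qcommutator q \<yy> (b^n * e) - (q - q powi (-3)) \<odot> (\<yy> * (b^n * e)))"
    unfolding w using qcommutator_y_xxyy[OF assms(1) \<open>y_weight w = - 2\<close>, folded b_def]
    by (simp only:)
  then show ?case
    using Suc by (simp add: mult.assoc)
qed simp

lemma qcommutator_power_yyxx_y:
  fixes q :: "'f::field"
  assumes "q \<noteq> 0" and "y_weight v = 2"
  defines "b \<equiv> \<yy>*\<yy>*\<xx>*\<xx>" and "e \<equiv> Poly_Mapping.single v 1"
  shows "qcommutator q (b^n * e) \<yy> = b^n * qcommutator q e \<yy>"
proof (induction n)
  case (Suc n)
  obtain w where w: "b^n * e = Poly_Mapping.single w 1" and "y_weight w = 2"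
    using ex_word_power_mult[where 'f = 'f, of "[Y, Y, X, X]" n v] assms(2)
    unfolding b_def e_def block_words by (auto simp: y_weight_simps)
  have "b^Suc n * e = Poly_Mapping.single (Y # Y # X # X # w) 1"
    by (simp add: mult.assoc w) (simp add: b_def block_words single_word_mult)
  then have "qcommutator q (b^Suc n * e) \<yy> = b * qcommutator q (b^n * e) \<yy>"
    unfolding w using qcommutator_yyxx_y[OF assms(1) \<open>y_weight w = 2\<close>, folded b_def]
    by (simp only:)
  then show ?case
    using Suc by (simp add: mult.assoc)
qed simp

theorem proposition4p6:
  fixes q :: "'f::field_char_0" and n :: nat
  assumes "q \<noteq> 0"
    and "\<And>k::nat. 0 < k \<Longrightarrow> q ^ k \<noteq> 1"
  shows
    "qcommutator q \<yy> ((\<xx>*\<xx>*\<yy>*\<yy>)^n * \<xx>*\<xx>*\<yy>) =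
       (q - q powi (-3)) \<odot> (\<yy>*\<xx>*\<xx> * (\<yy>*\<yy>*\<xx>*\<xx>)^n * \<yy> - (\<xx>*\<xx>*\<yy>*\<yy>)^(n+1))
     \<and> qcommutator q ((\<yy>*\<yy>*\<xx>*\<xx>)^n * \<yy>*\<yy>*\<xx>) \<yy> = 0
     \<and> qcommutator q \<yy> ((\<xx>*\<xx>*\<yy>*\<yy>)^n * \<xx>) =
       (q - q powi (-3)) \<odot> (\<yy> * (\<xx>*\<xx>*\<yy>*\<yy>)^n * \<xx>)
     \<and> qcommutator q ((\<yy>*\<yy>*\<xx>*\<xx>)^n * \<yy>) \<yy> =
       (q ^ 3 - q powi (-1)) \<odot> ((\<yy>*\<yy>*\<xx>*\<xx>)^n * \<yy>*\<yy>)"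
proof -
  define d where "d = q - q powi (-3)"
  define A B :: "'f free_alg" where "A = \<xx>*\<xx>*\<yy>*\<yy>" and "B = \<yy>*\<yy>*\<xx>*\<xx>"
  have words: "\<xx>*\<xx>*\<yy> = Poly_Mapping.single [X, X, Y] (1::'f)"
    "\<yy>*\<yy>*\<xx> = Poly_Mapping.single [Y, Y, X] (1::'f)"
    "\<yy>*\<xx> = Poly_Mapping.single [Y, X] (1::'f)" "\<yy>*\<yy> = Poly_Mapping.single [Y, Y] (1::'f)"
    "\<xx> = Poly_Mapping.single [X] (1::'f)" "\<yy> = Poly_Mapping.single [Y] (1::'f)"
    by (simp_all add: gen_def single_word_mult)
  \<comment> \<open>Both sides spell \<open>xxyyxx\<close>.\<close>
  have "\<xx>*\<xx> * B = A * (\<xx>*\<xx>)"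
    by (simp add: A_def B_def mult.assoc)
  then have power_commute: "\<xx>*\<xx> * B^n = A^n * (\<xx>*\<xx>)"
    by (rule mult_power_intertwine)
  \<comment> \<open>Only the insertion after \<open>xx\<close>, at prefix weight \<open>-4\<close>,
    survives; its coefficient is \<open>q^(-3) - q\<close>.\<close>
  have base1: "qcommutator q \<yy> (\<xx>*\<xx>*\<yy>) - d \<odot> (\<yy> * (\<xx>*\<xx>*\<yy>)) = - (d \<odot> A)"
    unfolding A_def block_words unfolding words(1) qcommutator_y_word d_def
    by (simp add: insertion_simps power_int_collect \<open>q \<noteq> 0\<close>
        del: word_qshuffle.simps power_int_numeral)
  have base2: "qcommutator q (\<yy>*\<yy>*\<xx>) \<yy> = 0"
    unfolding words(2) qcommutator_word_y
    by (simp add: insertion_simps power_int_collect \<open>q \<noteq> 0\<close>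
        del: word_qshuffle.simps power_int_numeral)
  have base3: "qcommutator q \<yy> \<xx> - d \<odot> (\<yy> * \<xx>) = 0"
    using qcommutator_y_word[of q "[X]"] unfolding words(5)[symmetric] d_def
    by (simp add: words(3,4) insertion_simps power_int_collect \<open>q \<noteq> 0\<close>
        del: word_qshuffle.simps power_int_numeral)
  \<comment> \<open>Only the front insertion contributes: the one after \<open>y\<close> has prefix
    weight \<open>2\<close> and coefficient zero.\<close>
  have base4: "qcommutator q \<yy> \<yy> = (q powi 3 - q powi (-1)) \<odot> (\<yy> * \<yy>)"
    using qcommutator_word_y[of q "[Y]"] unfolding words(6)[symmetric]
    by (simp add: words(3,4) insertion_simps power_int_collect \<open>q \<noteq> 0\<close>
        del: word_qshuffle.simps power_int_numeral)
  have rel1: "qcommutator q \<yy> (A^n * (\<xx>*\<xx>*\<yy>)) - d \<odot> (\<yy> * (A^n * (\<xx>*\<xx>*\<yy>)))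
      = - (d \<odot> A^(n+1))"
  proof -
    have "qcommutator q \<yy> (A^n * (\<xx>*\<xx>*\<yy>)) - d \<odot> (\<yy> * (A^n * (\<xx>*\<xx>*\<yy>)))
        = A^n * - (d \<odot> A)"
      using qcommutator_y_power_xxyy[of q "[X, X, Y]" n] \<open>q \<noteq> 0\<close>
      unfolding base1[symmetric] by (simp add: words(1) y_weight_simps A_def d_def)
    then show ?thesis
      by (simp add: mult_scal_right flip: power_Suc2)
  qed
  have rel2: "qcommutator q (B^n * (\<yy>*\<yy>*\<xx>)) \<yy> = 0"
    using qcommutator_power_yyxx_y[of q "[Y, Y, X]" n] base2 \<open>q \<noteq> 0\<close>
    by (simp add: words(2) y_weight_simps B_def)
  have rel3: "qcommutator q \<yy> (A^n * \<xx>) - d \<odot> (\<yy> * (A^n * \<xx>)) = 0"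
    using qcommutator_y_power_xxyy[of q "[X]" n] base3 \<open>q \<noteq> 0\<close>
    by (simp add: words(5)[symmetric] y_weight_simps A_def d_def)
  have rel4: "qcommutator q (B^n * \<yy>) \<yy> = (q ^ 3 - q powi (-1)) \<odot> (B^n * (\<yy> * \<yy>))"
    using qcommutator_power_yyxx_y[of q "[Y]" n] base4 \<open>q \<noteq> 0\<close>
    by (simp add: words(6)[symmetric] y_weight_simps B_def mult_scal_right)
  \<comment> \<open>The front insertion of the first relation is regrouped into blocks
    \<open>yyxx\<close>.\<close>
  have "\<yy> * (A^n * (\<xx>*\<xx>*\<yy>)) = \<yy>*\<xx>*\<xx> * B^n * \<yy>"
    using arg_cong[OF power_commute, of "\<lambda>p. \<yy> * p * \<yy>"] by (simp only: mult.assoc)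
  with rel1 have "qcommutator q \<yy> (A^n * \<xx>*\<xx>*\<yy>) = d \<odot> (\<yy>*\<xx>*\<xx> * B^n * \<yy> - A^(n+1))"
    by (simp add: scal_def right_diff_distrib mult.assoc diff_eq_eq)
  then show ?thesis
    using rel2 rel3 rel4 unfolding A_def[symmetric] B_def[symmetric] d_def[symmetric]
    by (simp add: mult.assoc)
qed

end
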